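(* Let $X$ be a compact Riemann surface with $X\cong\mathbb{CP}^1$. Then $X$ is simply connected, so that the first singular homology group $H_1(X;\mathbb{C})$ is trivial, and the genus of $X$ is necessarily zero.
   Context: The isomorphism $X\cong\mathbb{CP}^1$ is an isomorphism of complex manifolds. The genus of $X$ is defined here as half of the first Betti number, i.e. half of $\dim_{\mathbb{C}}H_1(X;\mathbb{C})$. *)

theory Defs
  imports
    "HOL-Complex_Analysis.Complex_Analysis"
    "HOL-Homology.Homology"
    "Jordan_Normal_Form.Missing_VectorSpace"
begin

unbundle no Formal_Power_Series.fps_syntax

hide_const (open) Modules.module

section \<open>Riemann surfaces\<close>

text \<open>A chart is a pair of its domain and a coordinate function; the values of the coordinate function
  outside the domain are irrelevant.\<close>

type_synonym 'a chart = "'a set \<times> ('a \<Rightarrow> complex)"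

definition is_chart :: "'a topology \<Rightarrow> 'a chart \<Rightarrow> bool" where
  "is_chart X c \<longleftrightarrow> (case c of (U, \<phi>) \<Rightarrow>
     openin X U \<and> open (\<phi> ` U) \<and>
     homeomorphic_map (subtopology X U) (top_of_set (\<phi> ` U)) \<phi>)"

definition holomorphically_compatible :: "'a chart \<Rightarrow> 'a chart \<Rightarrow> bool" where
  "holomorphically_compatible c d \<longleftrightarrow> (case (c, d) of ((U, \<phi>), (V, \<psi>)) \<Rightarrow>
     (\<psi> \<circ> inv_into U \<phi>) holomorphic_on \<phi> ` (U \<inter> V))"

definition complex_atlas :: "'a topology \<Rightarrow> 'a chart set \<Rightarrow> bool" where
  "complex_atlas X A \<longleftrightarrow>
     (\<forall>c\<in>A. is_chart X c) \<and>
     (\<Union>c\<in>A. fst c) = topspace X \<and>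
     (\<forall>c\<in>A. \<forall>d\<in>A. holomorphically_compatible c d)"

text \<open>The atlas need not be maximal. Second countability is not required: it is automatic for
  a compact space covered by charts (and for all Riemann surfaces, by Rado's theorem).\<close>

definition riemann_surface :: "'a topology \<Rightarrow> 'a chart set \<Rightarrow> bool" where
  "riemann_surface X A \<longleftrightarrow>
     topspace X \<noteq> {} \<and> connected_space X \<and> Hausdorff_space X \<and> complex_atlas X A"

definition holomorphic_map ::
  "'a topology \<Rightarrow> 'a chart set \<Rightarrow> 'b topology \<Rightarrow> 'b chart set \<Rightarrow> ('a \<Rightarrow> 'b) \<Rightarrow> bool" where
  "holomorphic_map X A Y B f \<longleftrightarrow>
     continuous_map X Y f \<and>
     (\<forall>(U, \<phi>)\<in>A. \<forall>(V, \<psi>)\<in>B.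
        (\<psi> \<circ> f \<circ> inv_into U \<phi>) holomorphic_on \<phi> ` {x \<in> U. f x \<in> V})"

definition biholomorphic ::
  "'a topology \<Rightarrow> 'a chart set \<Rightarrow> 'b topology \<Rightarrow> 'b chart set \<Rightarrow> bool" where
  "biholomorphic X A Y B \<longleftrightarrow>
     (\<exists>f g. holomorphic_map X A Y B f \<and> holomorphic_map Y B X A g \<and>
        (\<forall>x\<in>topspace X. g (f x) = x) \<and> (\<forall>y\<in>topspace Y. f (g y) = y))"


section \<open>The complex projective line\<close>

text \<open>The point with homogeneous coordinates \<open>v\<close> is the orbit of \<open>v\<close> under the nonzero scalars.\<close>

definition cp1_point :: "complex ^ 2 \<Rightarrow> (complex ^ 2) set" where
  "cp1_point v = {c *s v | c. c \<noteq> 0}"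

definition cp1_carrier :: "(complex ^ 2) set set" where
  "cp1_carrier = cp1_point ` (- {0})"

text \<open>The quotient topology of the punctured plane.\<close>

definition cp1_topology :: "(complex ^ 2) set topology" where
  "cp1_topology = topology (\<lambda>U. U \<subseteq> cp1_carrier \<and> open {v. v \<noteq> 0 \<and> cp1_point v \<in> U})"

text \<open>The affine coordinate \<open>v $ j / v $ i\<close> on the set of points with nonzero \<open>i\<close>-th coordinate.\<close>

definition cp1_chart :: "2 \<Rightarrow> 2 \<Rightarrow> (complex ^ 2) set chart" where
  "cp1_chart i j = (cp1_point ` {v. v $ i \<noteq> 0}, \<lambda>P. THE z. \<forall>v\<in>P. z = v $ j / v $ i)"

definition cp1_atlas :: "(complex ^ 2) set chart set" where
  "cp1_atlas = {cp1_chart 1 2, cp1_chart 2 1}"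

lemma openin_cp1_topology:
  "openin cp1_topology U \<longleftrightarrow> U \<subseteq> cp1_carrier \<and> open {v. v \<noteq> 0 \<and> cp1_point v \<in> U}"
proof -
  let ?L = "\<lambda>U. U \<subseteq> cp1_carrier \<and> open {v. v \<noteq> 0 \<and> cp1_point v \<in> U}"
  have "istopology ?L"
    unfolding istopology_def
  proof (intro conjI allI impI)
    fix S T assume "?L S" "?L T"
    moreover have "{v. v \<noteq> 0 \<and> cp1_point v \<in> S \<inter> T} =
        {v. v \<noteq> 0 \<and> cp1_point v \<in> S} \<inter> {v. v \<noteq> 0 \<and> cp1_point v \<in> T}" by auto
    ultimately show "S \<inter> T \<subseteq> cp1_carrier" "open {v. v \<noteq> 0 \<and> cp1_point v \<in> S \<inter> T}" by auto
  next
    fix K assume K: "\<forall>S\<in>K. ?L S"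
    moreover have "{v. v \<noteq> 0 \<and> cp1_point v \<in> \<Union>K} = (\<Union>S\<in>K. {v. v \<noteq> 0 \<and> cp1_point v \<in> S})" by auto
    ultimately show "\<Union>K \<subseteq> cp1_carrier" "open {v. v \<noteq> 0 \<and> cp1_point v \<in> \<Union>K}" by auto
  qed
  then show ?thesis
    unfolding cp1_topology_def by (simp add: topology_inverse')
qed

lemma topspace_cp1_topology [simp]: "topspace cp1_topology = cp1_carrier"
proof -
  have "{v. v \<noteq> 0 \<and> cp1_point v \<in> cp1_carrier} = - {0}"
    by (auto simp: cp1_carrier_def)
  then have "openin cp1_topology cp1_carrier"
    by (simp add: openin_cp1_topology open_Compl)
  then show ?thesis
    by (metis openin_cp1_topology openin_subset openin_topspace subset_antisym)
qed

lemma cp1_point_eq_iff: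
  "cp1_point v = cp1_point w \<longleftrightarrow> (\<exists>c. c \<noteq> 0 \<and> v = c *s w)"
proof
  assume "cp1_point v = cp1_point w"
  moreover have "v \<in> cp1_point v"
    unfolding cp1_point_def by (force intro: exI[of _ 1])
  ultimately show "\<exists>c. c \<noteq> 0 \<and> v = c *s w"
    unfolding cp1_point_def by auto
next
  assume "\<exists>c. c \<noteq> 0 \<and> v = c *s w"
  then obtain c where c: "c \<noteq> 0" "v = c *s w" by auto
  show "cp1_point v = cp1_point w"
  proof (intro equalityI subsetI)
    fix x assume "x \<in> cp1_point v"
    then obtain d where "d \<noteq> 0" "x = d *s v" by (auto simp: cp1_point_def)
    then have "d * c \<noteq> 0" "x = (d * c) *s w" using c by (auto simp: vector_smult_assoc)
    then show "x \<in> cp1_point w" unfolding cp1_point_def by blast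
  next
    fix x assume "x \<in> cp1_point w"
    then obtain d where "d \<noteq> 0" "x = d *s w" by (auto simp: cp1_point_def)
    then have "d / c \<noteq> 0" "x = (d / c) *s v" using c by (auto simp: vector_smult_assoc)
    then show "x \<in> cp1_point v" unfolding cp1_point_def by blast
  qed
qed

lemma cp1_point_in_chart_iff [simp]:
  "cp1_point v \<in> fst (cp1_chart i j) \<longleftrightarrow> v $ i \<noteq> 0"
  by (auto simp: cp1_chart_def cp1_point_eq_iff)

lemma cp1_chart_point [simp]:
  assumes "v $ i \<noteq> 0"
  shows "snd (cp1_chart i j) (cp1_point v) = v $ j / v $ i"
proof -
  have "v \<in> cp1_point v"
    unfolding cp1_point_def by (force intro: exI[of _ 1])
  then show ?thesis
    using assms unfolding cp1_chart_def snd_conv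
    by (intro the_equality) (auto simp: cp1_point_def)
qed

lemma continuous_map_cp1_point: "continuous_map (top_of_set (- {0})) cp1_topology cp1_point"
proof -
  have "{x. x \<noteq> 0 \<and> cp1_point x \<in> U} = {x \<in> - {0}. cp1_point x \<in> U}" for U by auto
  then show ?thesis
    unfolding continuous_map_def
    by (auto simp: openin_cp1_topology cp1_carrier_def openin_open_eq open_Compl)
qed

lemma cp1_index_cases: "i \<noteq> j \<Longrightarrow> (k::2) = i \<or> k = j"
  by (metis exhaust_2)

lemma cp1_chart_homeomorphic:
  assumes "i \<noteq> j"
  defines "w \<equiv> (\<lambda>z. \<chi> k. if k = i then 1 else z)"
  shows "homeomorphic_maps (subtopology cp1_topology (fst (cp1_chart i j))) euclidean
           (snd (cp1_chart i j)) (\<lambda>z. cp1_point (w z))"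
    and "openin cp1_topology (fst (cp1_chart i j))"
proof -
  let ?D = "fst (cp1_chart i j)" and ?f = "snd (cp1_chart i j)"
  have opD: "open {v::complex^2. v $ i \<noteq> 0}"
    by (intro open_Collect_neq continuous_intros)
  have nz: "v \<noteq> 0" if "v $ k \<noteq> 0" for v :: "complex^2" and k using that by auto
  have D: "?D \<subseteq> cp1_carrier"
    unfolding cp1_chart_def cp1_carrier_def fst_conv using nz by (intro image_mono) auto
  have "{v. v \<noteq> 0 \<and> cp1_point v \<in> ?D} = {v. v $ i \<noteq> 0}" by (auto simp: nz)
  then show op: "openin cp1_topology ?D"
    using opD D by (simp add: openin_cp1_topology)
  have w: "w z $ i = 1" "w z $ j = z" for z using assms by (auto simp: w_def)
  have wv: "cp1_point (w (v $ j / v $ i)) = cp1_point v" if "v $ i \<noteq> 0" for v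
  proof -
    have "(v $ i) * w (v $ j / v $ i) $ k = v $ k" for k
      using that cp1_index_cases[OF assms(1), of k] by (auto simp: w)
    then have "v = (v $ i) *s w (v $ j / v $ i)"
      by (simp add: vec_eq_iff)
    with that show ?thesis by (metis cp1_point_eq_iff)
  qed
  have elim: "\<exists>v. v $ i \<noteq> 0 \<and> P = cp1_point v" if "P \<in> ?D" for P
    using that by (auto simp: cp1_chart_def)
  have c1: "continuous_map (subtopology cp1_topology ?D) euclidean ?f"
    unfolding continuous_map_def
  proof (intro conjI allI impI)
    fix U :: "complex set" assume "openin euclidean U"
    then have "open U" by simp
    have "continuous_on {v::complex^2. v $ i \<noteq> 0} (\<lambda>v. v $ j / v $ i)"
      by (intro continuous_intros) auto
    then have "open ({v::complex^2. v $ i \<noteq> 0} \<inter> (\<lambda>v. v $ j / v $ i) -` U)"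
      using \<open>open U\<close> opD by (simp add: continuous_on_open_vimage Int_commute)
    moreover have "{v. v \<noteq> 0 \<and> cp1_point v \<in> {P \<in> ?D. ?f P \<in> U}} =
        {v::complex^2. v $ i \<noteq> 0} \<inter> (\<lambda>v. v $ j / v $ i) -` U"
      by (auto simp: nz)
    ultimately have "openin cp1_topology {P \<in> ?D. ?f P \<in> U}"
      using D by (auto simp: openin_cp1_topology)
    moreover have "topspace (subtopology cp1_topology ?D) = ?D" using D by auto
    ultimately show "openin (subtopology cp1_topology ?D)
        {P \<in> topspace (subtopology cp1_topology ?D). ?f P \<in> U}"
      using op by (simp add: openin_open_subtopology)
  qed auto
  have "continuous_on UNIV w"
    unfolding w_def continuous_on_vec_lambda
    apply (rule continuous_on_vec_lambda)
    subgoal for k by (cases "k = i") (auto intro: continuous_intros)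
    done
  then have "continuous_map euclidean (top_of_set (- {0})) w"
    using w nz by (auto simp: continuous_map_in_subtopology) (metis one_neq_zero zero_index)
  then have "continuous_map euclidean cp1_topology (cp1_point \<circ> w)"
    using continuous_map_cp1_point continuous_map_compose by blast
  then have c2: "continuous_map euclidean (subtopology cp1_topology ?D) (\<lambda>z. cp1_point (w z))"
    by (auto simp: continuous_map_in_subtopology o_def w)
  show "homeomorphic_maps (subtopology cp1_topology ?D) euclidean ?f (\<lambda>z. cp1_point (w z))"
    unfolding homeomorphic_maps_def
    using c1 c2 elim by (fastforce simp: w wv)
qed


lemma riemann_surface_cp1: "riemann_surface cp1_topology cp1_atlas"
proof -
  have one2: "(1::2) \<noteq> 2" "(2::2) \<noteq> 1" by simp_all
  have chart: "is_chart cp1_topology (cp1_chart i j) \<and> snd (cp1_chart i j) ` fst (cp1_chart i j) = UNIV"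
    if ij: "i \<noteq> j" for i j
  proof -
    note h = cp1_chart_homeomorphic[OF ij]
    have D: "topspace (subtopology cp1_topology (fst (cp1_chart i j))) = fst (cp1_chart i j)"
      using openin_subset[OF h(2)] by (auto simp: topspace_subtopology)
    have hm: "homeomorphic_map (subtopology cp1_topology (fst (cp1_chart i j))) euclidean (snd (cp1_chart i j))"
      using h(1) homeomorphic_map_maps by blast
    then have im: "snd (cp1_chart i j) ` fst (cp1_chart i j) = UNIV"
      using homeomorphic_imp_surjective_map[OF hm] D by simp
    then show ?thesis
      using h(2) hm unfolding is_chart_def by (simp add: case_prod_beta)
  qed
  have inv: "inv_into (fst (cp1_chart i j)) (snd (cp1_chart i j)) z =
      cp1_point (\<chi> k. if k = i then 1 else z)" if ij: "i \<noteq> j" for i j z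
  proof -
    have "inj_on (snd (cp1_chart i j)) (fst (cp1_chart i j))"
      using cp1_chart_homeomorphic(1)[OF ij] openin_subset[OF cp1_chart_homeomorphic(2)[OF ij]]
      unfolding homeomorphic_maps_def
      by (intro inj_on_inverseI[where g = "\<lambda>z. cp1_point (\<chi> k. if k = i then 1 else z)"]) auto
    then show ?thesis
      using ij by (intro inv_into_f_eq) auto
  qed
  have compat_same: "holomorphically_compatible (cp1_chart i j) (cp1_chart i j)" if ij: "i \<noteq> j" for i j
  proof -
    have "(snd (cp1_chart i j) \<circ> inv_into (fst (cp1_chart i j)) (snd (cp1_chart i j))) = id"
      using ij by (auto simp: fun_eq_iff inv[OF ij])
    then show ?thesis
      unfolding holomorphically_compatible_def
      by (simp add: case_prod_beta id_def)
  qed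
  have compat: "holomorphically_compatible (cp1_chart i j) (cp1_chart j i)" if ij: "i \<noteq> j" for i j
  proof -
    have hol: "(\<lambda>z. 1 / z) holomorphic_on snd (cp1_chart i j) ` (fst (cp1_chart i j) \<inter> fst (cp1_chart j i))"
    proof (intro holomorphic_intros)
      fix z assume "z \<in> snd (cp1_chart i j) ` (fst (cp1_chart i j) \<inter> fst (cp1_chart j i))"
      then obtain P where P: "P \<in> fst (cp1_chart i j)" "P \<in> fst (cp1_chart j i)" "z = snd (cp1_chart i j) P"
        by blast
      then obtain v where v: "P = cp1_point v" by (auto simp: cp1_chart_def)
      then have "v $ i \<noteq> 0" "v $ j \<noteq> 0" using P by simp_all
      then show "z \<noteq> 0" using P v by simp
    qed
    have eq: "(snd (cp1_chart j i) \<circ> inv_into (fst (cp1_chart i j)) (snd (cp1_chart i j))) z = 1 / z"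
      if z: "z \<in> snd (cp1_chart i j) ` (fst (cp1_chart i j) \<inter> fst (cp1_chart j i))" for z
    proof -
      from z obtain P where P: "P \<in> fst (cp1_chart i j)" "P \<in> fst (cp1_chart j i)" "z = snd (cp1_chart i j) P"
        by blast
      then obtain v where v: "P = cp1_point v" by (auto simp: cp1_chart_def)
      then have "v $ i \<noteq> 0" "v $ j \<noteq> 0" using P by simp_all
      then have "z \<noteq> 0" using P v by simp
      then show ?thesis using ij by (simp add: inv[OF ij])
    qed
    show ?thesis
      unfolding holomorphically_compatible_def case_prod_beta fst_conv snd_conv
      by (rule holomorphic_transform[OF hol]) (simp only: eq)
  qed
  have cover: "fst (cp1_chart 1 2) \<union> fst (cp1_chart 2 1) = cp1_carrier"
  proof -
    have "{v::complex^2. v $ 1 \<noteq> 0} \<union> {v. v $ 2 \<noteq> 0} = - {0}"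
      by (auto simp: vec_eq_iff forall_2)
    then show ?thesis
      unfolding cp1_chart_def cp1_carrier_def fst_conv by (metis image_Un)
  qed
  have "connectedin cp1_topology (cp1_point ` (- {0}))"
  proof (rule connectedin_continuous_map_image[OF continuous_map_cp1_point])
    have "connected (- {0 :: complex^2})"
      by (rule connected_punctured_universe) (simp add: DIM_cart)
    then show "connectedin (top_of_set (- {0 :: complex^2})) (- {0})"
      by (simp add: connectedin_subtopology)
  qed
  then have conn: "connected_space cp1_topology"
    by (metis cp1_carrier_def connectedin_topspace topspace_cp1_topology)
  have haus: "Hausdorff_space cp1_topology"
    unfolding Hausdorff_space_def
  proof (intro allI impI)
    fix P Q assume "P \<in> topspace cp1_topology \<and> Q \<in> topspace cp1_topology \<and> P \<noteq> Q"
    then obtain p q where pq: "p \<noteq> 0" "P = cp1_point p" "q \<noteq> 0" "Q = cp1_point q" "P \<noteq> Q"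
      by (auto simp: cp1_carrier_def)
    define d where "d = (\<lambda>v::complex^2. norm (v $ 1 * q $ 2 - v $ 2 * q $ 1))"
    define n where "n = (\<lambda>v::complex^2. norm (v $ 1) + norm (v $ 2))"
    have npos: "n v > 0" if "v \<noteq> 0" for v
      using that unfolding n_def vec_eq_iff forall_2
      by (smt (verit) norm_ge_zero zero_index zero_less_norm_iff)
    have hom: "d (c *s v) = norm c * d v" "n (c *s v) = norm c * n v" for c v
      by (simp_all add: d_def n_def norm_mult distrib_left mult.assoc flip: right_diff_distrib)
    have "d p \<noteq> 0"
    proof
      assume "d p = 0"
      then have e: "p $ 1 * q $ 2 = p $ 2 * q $ 1" by (simp add: d_def)
      obtain i where i: "q $ i \<noteq> 0" using \<open>q \<noteq> 0\<close> by (auto simp: vec_eq_iff)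
      have pe: "p $ k = (p $ i / q $ i) * q $ k" for k
        using e i exhaust_2[of i] exhaust_2[of k] by (auto simp: field_simps)
      then have "p = (p $ i / q $ i) *s q"
        by (intro vec_eq_iff[THEN iffD2] allI) (simp only: vector_smult_component pe[symmetric])
      moreover have "p $ i / q $ i \<noteq> 0"
        using pe \<open>p \<noteq> 0\<close> by (metis mult_zero_left vec_eq_iff zero_index)
      ultimately have "P = Q" using pq cp1_point_eq_iff by metis
      then show False using pq by simp
    qed
    then have dp: "d p > 0" by (simp add: d_def)
    define e where "e = d p / (2 * n p)"
    have e: "e > 0" using dp npos[OF pq(1)] by (simp add: e_def)
    have cont: "continuous_on UNIV d" "continuous_on UNIV n"
      unfolding d_def n_def by (intro continuous_intros)+
    have sat: "cp1_point v \<in> cp1_point ` {v. v \<noteq> 0 \<and> R (e * n v) (d v)} \<longleftrightarrow> v \<noteq> 0 \<and> R (e * n v) (d v)"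
      if R: "R = (<) \<or> R = (>)" for R :: "real \<Rightarrow> real \<Rightarrow> bool" and v
    proof
      assume "cp1_point v \<in> cp1_point ` {v. v \<noteq> 0 \<and> R (e * n v) (d v)}"
      then obtain u where u: "u \<noteq> 0" "R (e * n u) (d u)" "cp1_point v = cp1_point u" by auto
      then obtain c where c: "c \<noteq> 0" "v = c *s u" using cp1_point_eq_iff by metis
      have "v \<noteq> 0" using c u(1) by simp
      moreover have "R (norm c * (e * n u)) (norm c * d u)"
        using R u(2) c(1) by auto
      then have "R (e * n v) (d v)" by (simp add: c(2) hom mult.left_commute)
      ultimately show "v \<noteq> 0 \<and> R (e * n v) (d v)" by simp
    qed auto
    define U where "U = cp1_point ` {v. v \<noteq> 0 \<and> e * n v < d v}"
    define V where "V = cp1_point ` {v. v \<noteq> 0 \<and> e * n v > d v}"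
    have eqs: "{v. v \<noteq> 0 \<and> cp1_point v \<in> U} = - {0} \<inter> {v. e * n v < d v}"
              "{v. v \<noteq> 0 \<and> cp1_point v \<in> V} = - {0} \<inter> {v. d v < e * n v}"
      using sat[of "(<)"] sat[of "(>)"] by (auto simp: U_def V_def)
    have "open (- {0} \<inter> {v. e * n v < d v})" "open (- {0} \<inter> {v. d v < e * n v})"
      by (intro open_Int open_Compl closed_singleton open_Collect_less continuous_intros cont)+
    then have "openin cp1_topology U" "openin cp1_topology V"
      unfolding openin_cp1_topology eqs by (auto simp: U_def V_def cp1_carrier_def)
    moreover have "P \<in> U"
      using dp pq(1,2) npos[OF pq(1)] by (auto simp: U_def e_def)
    moreover have "Q \<in> V"
      using e pq(3,4) npos[OF pq(3)] by (auto simp: V_def d_def mult.commute)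
    moreover have "disjnt U V"
    proof -
      have False if "x \<in> U" "x \<in> V" for x
      proof -
        from that(1) obtain v where v: "x = cp1_point v" "v \<noteq> 0" by (auto simp: U_def)
        then have "v \<in> {v. v \<noteq> 0 \<and> cp1_point v \<in> U}" "v \<in> {v. v \<noteq> 0 \<and> cp1_point v \<in> V}"
          using that by auto
        then show False unfolding eqs by auto
      qed
      then show ?thesis by (auto simp: disjnt_def)
    qed
    ultimately show "\<exists>U V. openin cp1_topology U \<and> openin cp1_topology V \<and> P \<in> U \<and> Q \<in> V \<and> disjnt U V"
      by blast
  qed
  have ne: "cp1_carrier \<noteq> {}"
  proof -
    have "((\<chi> k. 1) :: complex^2) \<in> - {0}" by (simp add: vec_eq_iff)
    then show ?thesis unfolding cp1_carrier_def by blast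
  qed
  show ?thesis
    unfolding riemann_surface_def complex_atlas_def cp1_atlas_def
    using chart compat compat_same one2 cover conn haus ne by simp
qed


section \<open>Simple connectedness\<close>

text \<open>The library notion \<^const>\<open>simply_connected\<close> only covers subsets of a type class space.\<close>

definition simply_connected_space :: "'a topology \<Rightarrow> bool" where
  "simply_connected_space X \<longleftrightarrow>
     path_connected_space X \<and>
     (\<forall>p. pathin X p \<and> p 1 = p 0 \<longrightarrow>
        homotopic_with (\<lambda>q. q 0 = p 0 \<and> q 1 = p 0) (top_of_set {0..1}) X p (\<lambda>_. p 0))"


section \<open>Quotient modules\<close>

text \<open>The multiplicative fields of the ring record underlying a module play no role.\<close>

definition quotient_module ::
  "('a, 'b, 'm) module_scheme \<Rightarrow> 'b set \<Rightarrow> ('a, 'b set) module" where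
  "quotient_module M N =
     \<lparr>carrier = a_rcosets\<^bsub>M\<^esub> N, monoid.mult = undefined, one = undefined,
      zero = N, add = set_add M, module.smult = (\<lambda>a C. \<Union>x\<in>C. N +>\<^bsub>M\<^esub> (a \<odot>\<^bsub>M\<^esub> x))\<rparr>"

lemma module_quotient_module:
  assumes M: "module R M" and N: "Module.submodule N R M"
  shows "module R (quotient_module M N)"
proof -
  interpret M: module R M by (rule M)
  have sub: "subgroup N (add_monoid M)" using N by (simp add: Module.submodule_def)
  interpret N: abelian_subgroup N M
    by (rule abelian_subgroupI3) (auto simp: additive_subgroup_def sub M.abelian_group_axioms)
  have Nsm: "a \<odot>\<^bsub>M\<^esub> x \<in> N" if "a \<in> carrier R" "x \<in> N" for a x
    using N that by (auto simp: Module.submodule_def submodule_axioms_def)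
  let ?Q = "quotient_module M N"
  have smQ: "a \<odot>\<^bsub>?Q\<^esub> (N +>\<^bsub>M\<^esub> x) = N +>\<^bsub>M\<^esub> (a \<odot>\<^bsub>M\<^esub> x)"
    if "a \<in> carrier R" "x \<in> carrier M" for a x
  proof -
    have "N +>\<^bsub>M\<^esub> (a \<odot>\<^bsub>M\<^esub> y) = N +>\<^bsub>M\<^esub> (a \<odot>\<^bsub>M\<^esub> x)" if y: "y \<in> N +>\<^bsub>M\<^esub> x" for y
    proof -
      from y obtain h where h: "h \<in> N" "y = h \<oplus>\<^bsub>M\<^esub> x" by (auto simp: a_r_coset_def')
      then have "a \<odot>\<^bsub>M\<^esub> y = a \<odot>\<^bsub>M\<^esub> h \<oplus>\<^bsub>M\<^esub> a \<odot>\<^bsub>M\<^esub> x"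
        using that \<open>a \<in> carrier R\<close> \<open>x \<in> carrier M\<close> N.a_subset by (auto simp: M.smult_r_distr)
      then have "a \<odot>\<^bsub>M\<^esub> y \<in> N +>\<^bsub>M\<^esub> (a \<odot>\<^bsub>M\<^esub> x)"
        using Nsm[OF \<open>a \<in> carrier R\<close> h(1)] by (auto simp: a_r_coset_def')
      then show ?thesis
        using \<open>a \<in> carrier R\<close> \<open>x \<in> carrier M\<close> N.a_repr_independence' by (metis M.smult_closed)
    qed
    moreover have "x \<in> N +>\<^bsub>M\<^esub> x" using that N.a_rcos_self by blast
    ultimately have "(\<Union>y\<in>N +>\<^bsub>M\<^esub> x. N +>\<^bsub>M\<^esub> (a \<odot>\<^bsub>M\<^esub> y)) = N +>\<^bsub>M\<^esub> (a \<odot>\<^bsub>M\<^esub> x)"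
      by (intro UN_constant_eq) blast+
    then show ?thesis by (simp only: quotient_module_def module.simps)
  qed
  have carr: "carrier ?Q = (\<lambda>x. N +>\<^bsub>M\<^esub> x) ` carrier M"
    by (auto simp: quotient_module_def A_RCOSETS_def')
  have add: "(N +>\<^bsub>M\<^esub> x) \<oplus>\<^bsub>?Q\<^esub> (N +>\<^bsub>M\<^esub> y) = N +>\<^bsub>M\<^esub> (x \<oplus>\<^bsub>M\<^esub> y)"
    if "x \<in> carrier M" "y \<in> carrier M" for x y
    using N.a_rcos_sum[OF that] by (simp add: quotient_module_def)
  have zero: "\<zero>\<^bsub>?Q\<^esub> = N +>\<^bsub>M\<^esub> \<zero>\<^bsub>M\<^esub>"
    using N.a_subset by (simp add: quotient_module_def)
  have ab: "abelian_group ?Q"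
  proof (rule abelian_groupI)
    fix C assume "C \<in> carrier ?Q"
    then obtain x where x: "x \<in> carrier M" "C = N +>\<^bsub>M\<^esub> x" by (auto simp: carr)
    then have "(N +>\<^bsub>M\<^esub> (\<ominus>\<^bsub>M\<^esub> x)) \<oplus>\<^bsub>?Q\<^esub> C = \<zero>\<^bsub>?Q\<^esub>" by (simp add: add zero M.l_neg)
    with x show "\<exists>D\<in>carrier ?Q. D \<oplus>\<^bsub>?Q\<^esub> C = \<zero>\<^bsub>?Q\<^esub>" by (auto simp: carr)
  qed (auto simp: carr add zero M.a_ac)
  show ?thesis
    by (rule moduleI)
      (auto simp: module.axioms(1)[OF M] ab carr smQ add M.smult_l_distr M.smult_r_distr M.smult_assoc1)
qed


section \<open>Singular homology with complex coefficients\<close>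

definition complex_field :: "complex ring" where
  "complex_field = \<lparr>carrier = UNIV, monoid.mult = (*), one = 1, zero = 0, add = (+)\<rparr>"

lemma field_complex_field: "field complex_field"
proof -
  have "\<exists>y. y + x = 0" for x :: complex by (rule exI[of _ "- x"]) simp
  then have "cring complex_field"
    by (intro cringI abelian_groupI comm_monoidI) (auto simp: complex_field_def distrib_right)
  moreover have "\<exists>y. x * y = 1" if "x \<noteq> 0" for x :: complex
    using that by (intro exI[of _ "inverse x"]) simp
  ultimately show ?thesis
    by (rule_tac cring.cring_fieldI2) (auto simp: complex_field_def)
qed

type_synonym 'a complex_chain = "((nat \<Rightarrow> real) \<Rightarrow> 'a) \<Rightarrow>\<^sub>0 complex"

definition complex_chain_boundary :: "nat \<Rightarrow> 'a complex_chain \<Rightarrow> 'a complex_chain" where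
  "complex_chain_boundary p c =
     (if p = 0 then 0
      else \<Sum>f\<in>Poly_Mapping.keys c. \<Sum>k\<le>p.
             Poly_Mapping.single (singular_face p k f) ((-1) ^ k * Poly_Mapping.lookup c f))"

definition complex_chains :: "nat \<Rightarrow> 'a topology \<Rightarrow> 'a complex_chain set" where
  "complex_chains p X = {c. Poly_Mapping.keys c \<subseteq> singular_simplex_set p X}"

definition complex_cycles :: "nat \<Rightarrow> 'a topology \<Rightarrow> 'a complex_chain set" where
  "complex_cycles p X = {c \<in> complex_chains p X. complex_chain_boundary p c = 0}"

definition complex_boundaries :: "nat \<Rightarrow> 'a topology \<Rightarrow> 'a complex_chain set" where
  "complex_boundaries p X = complex_chain_boundary (Suc p) ` complex_chains (Suc p) X"

abbreviation chain_scale :: "complex \<Rightarrow> 'a complex_chain \<Rightarrow> 'a complex_chain" where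
  "chain_scale a \<equiv> Poly_Mapping.map ((*) a)"

definition complex_cycle_module :: "nat \<Rightarrow> 'a topology \<Rightarrow> (complex, 'a complex_chain) module" where
  "complex_cycle_module p X =
     \<lparr>carrier = complex_cycles p X, monoid.mult = undefined, one = undefined,
      zero = 0, add = (+), module.smult = chain_scale\<rparr>"

definition complex_homology :: "nat \<Rightarrow> 'a topology \<Rightarrow> (complex, 'a complex_chain set) module" where
  "complex_homology p X = quotient_module (complex_cycle_module p X) (complex_boundaries p X)"

text \<open>The dimension of an infinite-dimensional space is a junk value, but compact surfaces have
  finite-dimensional homology.\<close>

definition betti_number :: "nat \<Rightarrow> 'a topology \<Rightarrow> nat" where
  "betti_number p X = vectorspace.dim complex_field (complex_homology p X)"

definition genus :: "'a topology \<Rightarrow> real" where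
  "genus X = real (betti_number 1 X) / 2"


subsection \<open>Homology is a vector space\<close>

lemma lookup_chain_scale [simp]:
  "Poly_Mapping.lookup (chain_scale a c) f = a * Poly_Mapping.lookup c f"
  by (simp add: Poly_Mapping.map.rep_eq when_def)

lemma chain_scale_simps:
  "chain_scale a 0 = 0" "chain_scale 0 c = 0" "chain_scale 1 c = c"
  "chain_scale a (c + d) = chain_scale a c + chain_scale a d"
  "chain_scale (a + b) c = chain_scale a c + chain_scale b c"
  "chain_scale a (chain_scale b c) = chain_scale (a * b) c"
  by (rule poly_mapping_eqI, simp add: lookup_add algebra_simps)+

lemma chain_scale_single: "chain_scale a (Poly_Mapping.single f b) = Poly_Mapping.single f (a * b)"
  by (rule poly_mapping_eqI) (simp add: lookup_single when_def)

lemma chain_scale_sum: "chain_scale a (\<Sum>i\<in>I. g i) = (\<Sum>i\<in>I. chain_scale a (g i))"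
  by (induction I rule: infinite_finite_induct) (simp_all add: chain_scale_simps)

lemma complex_chain_boundary_superset:
  assumes "finite S" "Poly_Mapping.keys c \<subseteq> S" "p \<noteq> 0"
  shows "complex_chain_boundary p c = (\<Sum>f\<in>S. \<Sum>k\<le>p.
           Poly_Mapping.single (singular_face p k f) ((-1) ^ k * Poly_Mapping.lookup c f))"
  using assms unfolding complex_chain_boundary_def
  by (auto simp: in_keys_iff intro!: sum.mono_neutral_left sum.neutral)

lemma complex_chain_boundary_add:
  "complex_chain_boundary p (c + d) = complex_chain_boundary p c + complex_chain_boundary p d"
proof (cases "p = 0")
  case False
  let ?S = "Poly_Mapping.keys c \<union> Poly_Mapping.keys d"
  have "finite ?S" "Poly_Mapping.keys (c + d) \<subseteq> ?S"
    using Poly_Mapping.keys_add[of c d] by auto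
  then show ?thesis
    using False
    by (simp add: complex_chain_boundary_superset[of ?S] lookup_add distrib_left single_add sum.distrib)
qed (simp add: complex_chain_boundary_def)

lemma complex_chain_boundary_scale:
  "complex_chain_boundary p (chain_scale a c) = chain_scale a (complex_chain_boundary p c)"
proof (cases "p = 0")
  case False
  have "Poly_Mapping.keys (chain_scale a c) \<subseteq> Poly_Mapping.keys c"
    by (auto simp: in_keys_iff)
  then show ?thesis
    using False
    by (simp add: complex_chain_boundary_superset[of "Poly_Mapping.keys c"] chain_scale_sum
        chain_scale_single mult.left_commute)
qed (simp add: complex_chain_boundary_def chain_scale_simps)

lemma complex_chain_boundary_0 [simp]: "complex_chain_boundary p 0 = 0"
  by (simp add: complex_chain_boundary_def)

lemma complex_chain_boundary_sum:
  "complex_chain_boundary p (\<Sum>i\<in>I. g i) = (\<Sum>i\<in>I. complex_chain_boundary p (g i))"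
  by (induction I rule: infinite_finite_induct) (simp_all add: complex_chain_boundary_add)

definition complexify_chain :: "'a chain \<Rightarrow> 'a complex_chain" where
  "complexify_chain = Poly_Mapping.map of_int"

lemma lookup_complexify_chain [simp]:
  "Poly_Mapping.lookup (complexify_chain c) f = of_int (Poly_Mapping.lookup c f)"
  by (simp add: complexify_chain_def Poly_Mapping.map.rep_eq when_def)

lemma complexify_chain_0 [simp]: "complexify_chain 0 = 0"
  by (rule poly_mapping_eqI) simp

lemma complexify_chain_sum:
  "complexify_chain (\<Sum>i\<in>I. g i) = (\<Sum>i\<in>I. complexify_chain (g i))"
proof (induction I rule: infinite_finite_induct)
  case (insert x F)
  have "complexify_chain (c + d) = complexify_chain c + complexify_chain d" for c d :: "'a chain"
    by (rule poly_mapping_eqI) (simp add: lookup_add)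
  with insert show ?case by simp
qed simp_all

lemma complex_chain_boundary_complexify:
  "complex_chain_boundary p (complexify_chain c) = complexify_chain (chain_boundary p c)"
proof (cases "p = 0")
  case False
  have keys: "Poly_Mapping.keys (complexify_chain c) = Poly_Mapping.keys c"
    by (auto simp: in_keys_iff)
  have "complexify_chain (frag_cmul m (frag_cmul n (frag_of f))) = Poly_Mapping.single f (of_int n * of_int m)"
    for m n and f :: "(nat \<Rightarrow> real) \<Rightarrow> 'a"
    by (rule poly_mapping_eqI) (simp add: lookup_single when_def)
  then show ?thesis
    using False
    by (simp add: complex_chain_boundary_def chain_boundary_def frag_extend_def complexify_chain_sum
        frag_cmul_sum keys del: frag_cmul_cmul)
qed (simp add: complex_chain_boundary_def chain_boundary_def)

lemma complex_chain_expand: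
  fixes c :: "'a complex_chain"
  shows "c = (\<Sum>f\<in>Poly_Mapping.keys c. chain_scale (Poly_Mapping.lookup c f) (complexify_chain (frag_of f)))"
proof (rule poly_mapping_eqI)
  fix g
  have "(\<Sum>f\<in>Poly_Mapping.keys c. Poly_Mapping.lookup c f * of_int (if g = f then 1 else 0)) =
      (\<Sum>f\<in>Poly_Mapping.keys c. if f = g then Poly_Mapping.lookup c f else 0)"
    by (intro sum.cong) auto
  also have "\<dots> = Poly_Mapping.lookup c g"
    by (simp add: in_keys_iff)
  finally show "Poly_Mapping.lookup c g = Poly_Mapping.lookup
      (\<Sum>f\<in>Poly_Mapping.keys c. chain_scale (Poly_Mapping.lookup c f) (complexify_chain (frag_of f))) g"
    by (simp add: lookup_sum lookup_single)
qed

lemma complex_chain_boundary_boundary: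
  assumes "c \<in> complex_chains (Suc p) X"
  shows "complex_chain_boundary p (complex_chain_boundary (Suc p) c) = 0"
proof -
  have "chain_boundary p (chain_boundary (Suc p) (frag_of f)) = 0" if "f \<in> Poly_Mapping.keys c" for f
    using assms that chain_boundary_boundary_alt[of p X "frag_of f"]
    by (auto simp: complex_chains_def singular_chain_of)
  then show ?thesis
    by (subst complex_chain_expand[of c])
      (simp add: complex_chain_boundary_sum complex_chain_boundary_scale
        complex_chain_boundary_complexify chain_scale_simps)
qed

lemma keys_complex_chain_boundary:
  assumes "c \<in> complex_chains (Suc p) X"
  shows "complex_chain_boundary (Suc p) c \<in> complex_chains p X"
proof -
  have "Poly_Mapping.keys (complex_chain_boundary (Suc p) c) \<subseteq>
      (\<Union>f\<in>Poly_Mapping.keys c. \<Union>k\<le>Suc p. {singular_face (Suc p) k f})"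
    unfolding complex_chain_boundary_def
    apply (simp del: sum.atMost_Suc)
    apply (rule order_trans[OF keys_sum])
    apply (rule UN_mono[OF order_refl])
    apply (rule order_trans[OF keys_sum])
    apply (rule UN_mono[OF order_refl])
    apply simp
    done
  also have "\<dots> \<subseteq> singular_simplex_set p X"
    using assms singular_simplex_singular_face[of "Suc p" X]
    by (auto simp: complex_chains_def)
  finally show ?thesis by (simp add: complex_chains_def)
qed

lemma complex_chains_closed:
  "0 \<in> complex_chains p X"
  "c \<in> complex_chains p X \<Longrightarrow> d \<in> complex_chains p X \<Longrightarrow> c + d \<in> complex_chains p X"
  "c \<in> complex_chains p X \<Longrightarrow> chain_scale a c \<in> complex_chains p X"
  using Poly_Mapping.keys_add[of c d]
  by (auto simp: complex_chains_def in_keys_iff)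

lemma chain_scale_minus: "chain_scale (-1) c + c = 0"
  by (rule poly_mapping_eqI) (simp add: lookup_add)

lemma module_complex_cycle_module: "module complex_field (complex_cycle_module p X)"
proof -
  have cyc: "0 \<in> complex_cycles p X"
    "c \<in> complex_cycles p X \<Longrightarrow> d \<in> complex_cycles p X \<Longrightarrow> c + d \<in> complex_cycles p X"
    "c \<in> complex_cycles p X \<Longrightarrow> chain_scale a c \<in> complex_cycles p X" for a c d
    by (auto simp: complex_cycles_def complex_chains_closed complex_chain_boundary_add
        complex_chain_boundary_scale chain_scale_simps)
  have "abelian_group (complex_cycle_module p X)"
  proof (rule abelian_groupI)
    fix c assume "c \<in> carrier (complex_cycle_module p X)"
    then show "\<exists>d\<in>carrier (complex_cycle_module p X).
        d \<oplus>\<^bsub>complex_cycle_module p X\<^esub> c = \<zero>\<^bsub>complex_cycle_module p X\<^esub>"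
      using cyc(3)[of c "-1"] chain_scale_minus[of c] by (auto simp: complex_cycle_module_def)
  qed (auto simp: complex_cycle_module_def cyc add.assoc add.commute)
  moreover have "cring complex_field"
    using field_complex_field by (simp add: field_def domain_def)
  ultimately show ?thesis
    by (intro moduleI)
      (auto simp: complex_cycle_module_def complex_field_def cyc chain_scale_simps)
qed

lemma vectorspace_complex_homology: "vectorspace complex_field (complex_homology p X)"
proof -
  interpret M: module complex_field "complex_cycle_module p X" by (rule module_complex_cycle_module)
  have minus: "\<ominus>\<^bsub>complex_cycle_module p X\<^esub> c = chain_scale (-1) c"
    if "c \<in> carrier (complex_cycle_module p X)" for c
  proof (rule M.minus_equality)
    show "chain_scale (-1) c \<oplus>\<^bsub>complex_cycle_module p X\<^esub> c = \<zero>\<^bsub>complex_cycle_module p X\<^esub>"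
      by (simp add: complex_cycle_module_def chain_scale_minus)
    show "c \<in> carrier (complex_cycle_module p X)" by (rule that)
    show "chain_scale (-1) c \<in> carrier (complex_cycle_module p X)"
      using that M.smult_closed[of "-1" c] by (simp add: complex_cycle_module_def complex_field_def)
  qed
  have sub: "complex_boundaries p X \<subseteq> carrier (complex_cycle_module p X)"
    by (auto simp: complex_boundaries_def complex_cycle_module_def complex_cycles_def
        keys_complex_chain_boundary complex_chain_boundary_boundary)
  have closed: "0 \<in> complex_boundaries p X"
    "c \<in> complex_boundaries p X \<Longrightarrow> d \<in> complex_boundaries p X \<Longrightarrow> c + d \<in> complex_boundaries p X"
    "c \<in> complex_boundaries p X \<Longrightarrow> chain_scale a c \<in> complex_boundaries p X" for a c d
    unfolding complex_boundaries_def
    by (metis complex_chain_boundary_0 complex_chains_closed(1) image_eqI)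
      (auto simp: complex_chains_closed simp flip: complex_chain_boundary_add complex_chain_boundary_scale)
  have "Module.submodule (complex_boundaries p X) complex_field (complex_cycle_module p X)"
    using sub closed minus
    by (intro M.submoduleI) (auto simp: complex_cycle_module_def)
  then show ?thesis
    unfolding vectorspace_def complex_homology_def
    using module_quotient_module[OF module_complex_cycle_module] field_complex_field by blast
qed

end

theory Submission
  imports Defs
begin

text \<open>
  All three conclusions concern the underlying topological space only, and a biholomorphism is in
  particular a homeomorphism, so \<open>X\<close> may be compared with a model of \<open>CP\<^sup>1\<close>. The Hopf map sends
  \<open>[v\<^sub>1 : v\<^sub>2]\<close> to the point \<open>(2 v\<^sub>1 cnj v\<^sub>2, |v\<^sub>1|\<^sup>2 - |v\<^sub>2|\<^sup>2) / |v|\<^sup>2\<close> of the unit sphere of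
  \<open>C \<times> R\<close>. It is a continuous bijection from a compact space to a Hausdorff space, hence a
  homeomorphism (\<open>cp1_homeomorphic_sphere\<close>).

  Simple connectedness then follows from that of spheres in a Euclidean space of dimension three,
  since the topological notion is invariant under homeomorphism
  (\<open>simply_connected_space_homeomorphic\<close>).

  For homology, the group \<open>H\<^sub>1(S\<^sup>2; Z)\<close> vanishes, and for a path connected space this already forces
  \<open>H\<^sub>1\<close> with complex coefficients to vanish (\<open>complex_1_cycle_imp_boundary\<close>), with no universal
  coefficient theorem. Fix a base point \<open>b\<close> and integral chains \<open>\<gamma>\<^sub>s\<close> with \<open>\<partial>\<gamma>\<^sub>s = s - b\<close> for every point \<open>s\<close>.
  For a path \<open>\<sigma>\<close> from \<open>x\<close> to \<open>y\<close> the integral chain \<open>\<sigma> + \<gamma>\<^sub>x - \<gamma>\<^sub>y\<close> is a cycle, hence \<open>\<partial>d\<^sub>\<sigma>\<close> for some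
  \<open>d\<^sub>\<sigma>\<close>. If \<open>c = \<Sum> a\<^sub>\<sigma> \<sigma>\<close> is a complex cycle, then \<open>\<partial>(\<Sum> a\<^sub>\<sigma> d\<^sub>\<sigma>)\<close> differs from \<open>c\<close> by the image of
  \<open>\<partial>c = 0\<close> under the linear extension of \<open>\<gamma>\<close>, so it equals \<open>c\<close>. The genus is half the dimension of the
  resulting zero space.
\<close>

section \<open>The projective line is a two-sphere\<close>

text \<open>The Hopf map in homogeneous coordinates. Dividing by \<open>|v|\<^sup>2\<close> makes it invariant under nonzero
  scalars on all nonzero vectors, rather than just under the unit circle on unit vectors.\<close>

definition hopf_map :: "complex ^ 2 \<Rightarrow> complex \<times> real" where
  "hopf_map v = (2 * v $ 1 * cnj (v $ 2) / of_real ((norm v)\<^sup>2),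
                 ((norm (v $ 1))\<^sup>2 - (norm (v $ 2))\<^sup>2) / (norm v)\<^sup>2)"

lemma norm_vec2_squared:
  fixes v :: "complex ^ 2"
  shows "(norm v)\<^sup>2 = (norm (v $ 1))\<^sup>2 + (norm (v $ 2))\<^sup>2"
  by (simp add: norm_vec_def L2_set_def sum_2)

lemma norm_vec_smult:
  fixes v :: "complex ^ 2"
  shows "norm (c *s v) = norm c * norm v"
proof -
  have "(norm (c *s v))\<^sup>2 = (norm c * norm v)\<^sup>2"
    unfolding power_mult_distrib norm_vec2_squared
    by (simp add: norm_mult power_mult_distrib distrib_left)
  then show ?thesis by (simp add: power2_eq_iff_nonneg)
qed

lemma hopf_map_scale:
  assumes "c \<noteq> 0"
  shows "hopf_map (c *s v) = hopf_map v"
proof -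
  have n: "(norm (c *s v))\<^sup>2 = (norm c)\<^sup>2 * (norm v)\<^sup>2"
    by (simp add: norm_vec_smult power_mult_distrib)
  have c: "(norm c)\<^sup>2 \<noteq> 0" "complex_of_real ((norm c)\<^sup>2) \<noteq> 0" using assms by simp_all
  have "2 * (c * v $ 1) * cnj (c * v $ 2) = of_real ((norm c)\<^sup>2) * (2 * v $ 1 * cnj (v $ 2))"
    by (simp add: complex_norm_square algebra_simps del: of_real_power)
  moreover have "(norm (c * v $ 1))\<^sup>2 - (norm (c * v $ 2))\<^sup>2 = (norm c)\<^sup>2 * ((norm (v $ 1))\<^sup>2 - (norm (v $ 2))\<^sup>2)"
    by (simp add: norm_mult power_mult_distrib right_diff_distrib)
  ultimately show ?thesis
    using c unfolding hopf_map_def n prod.inject vector_smult_component of_real_mult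
    by (metis mult_divide_mult_cancel_left)
qed

lemma norm_hopf_map:
  assumes "v \<noteq> 0"
  shows "norm (hopf_map v) = 1"
proof -
  define a b where ab: "a = (norm (v $ 1))\<^sup>2" "b = (norm (v $ 2))\<^sup>2"
  have n: "(norm v)\<^sup>2 = a + b" by (simp add: norm_vec2_squared ab)
  have pos: "a + b > 0" using assms by (simp flip: n)
  have "(norm (fst (hopf_map v)))\<^sup>2 = 4 * a * b / (a + b)\<^sup>2"
    unfolding hopf_map_def fst_conv norm_divide norm_mult power_divide n power_mult_distrib norm_of_real
    by (simp add: ab)
  moreover have "(norm (snd (hopf_map v)))\<^sup>2 = (a - b)\<^sup>2 / (a + b)\<^sup>2"
    unfolding hopf_map_def snd_conv n ab[symmetric] by (simp add: power_divide)
  moreover have "(norm (hopf_map v))\<^sup>2 = (norm (fst (hopf_map v)))\<^sup>2 + (norm (snd (hopf_map v)))\<^sup>2"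
    by (simp add: norm_prod_def)
  moreover have "4 * a * b + (a - b)\<^sup>2 = (a + b)\<^sup>2"
    by (simp add: power2_eq_square algebra_simps)
  ultimately have "(norm (hopf_map v))\<^sup>2 = 1"
    using pos by (simp flip: add_divide_distrib)
  then show ?thesis
    using norm_ge_zero[of "hopf_map v"] by (auto simp: power2_eq_1_iff)
qed

text \<open>On unit vectors the Hopf map determines \<open>|v\<^sub>1|\<close>, \<open>|v\<^sub>2|\<close> and \<open>v\<^sub>1 cnj v\<^sub>2\<close>, and these determine the
  ratio of the coordinates.\<close>

lemma hopf_map_eq_imp:
  assumes "v \<noteq> 0" "w \<noteq> 0" and eq: "hopf_map v = hopf_map w"
  shows "cp1_point v = cp1_point w"
proof -
  have unit: "\<exists>u. norm u = 1 \<and> cp1_point u = cp1_point x \<and> hopf_map u = hopf_map x"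
    if "x \<noteq> 0" for x :: "complex ^ 2"
  proof (intro exI conjI)
    let ?c = "of_real (1 / norm x) :: complex"
    have c: "?c \<noteq> 0" using that by simp
    show "norm (?c *s x) = 1"
      using that by (simp add: norm_vec_smult norm_divide)
    show "cp1_point (?c *s x) = cp1_point x" using c cp1_point_eq_iff by blast
    show "hopf_map (?c *s x) = hopf_map x" by (rule hopf_map_scale[OF c])
  qed
  obtain p q where p: "norm p = 1" "cp1_point p = cp1_point v" "hopf_map p = hopf_map v"
    and q: "norm q = 1" "cp1_point q = cp1_point w" "hopf_map q = hopf_map w"
    using unit assms(1,2) by metis
  have "hopf_map p = hopf_map q" using p(3) q(3) eq by simp
  then have e: "p $ 1 * cnj (p $ 2) = q $ 1 * cnj (q $ 2)"
    and d: "(norm (p $ 1))\<^sup>2 - (norm (p $ 2))\<^sup>2 = (norm (q $ 1))\<^sup>2 - (norm (q $ 2))\<^sup>2"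
    by (simp_all add: hopf_map_def p(1) q(1))
  have s: "(norm (p $ 1))\<^sup>2 + (norm (p $ 2))\<^sup>2 = (norm (q $ 1))\<^sup>2 + (norm (q $ 2))\<^sup>2"
    by (metis norm_vec2_squared p(1) q(1))
  have n2: "norm (p $ 2) = norm (q $ 2)" and n1: "norm (p $ 1) = norm (q $ 1)"
  proof -
    have "(norm (p $ 2))\<^sup>2 = (norm (q $ 2))\<^sup>2" "(norm (p $ 1))\<^sup>2 = (norm (q $ 1))\<^sup>2"
      using d s by linarith+
    then show "norm (p $ 2) = norm (q $ 2)" "norm (p $ 1) = norm (q $ 1)"
      by (simp_all only: power2_eq_iff_nonneg norm_ge_zero)
  qed
  have "cp1_point p = cp1_point q"
  proof (cases "q $ 2 = 0")
    case True
    then have "p $ 2 = 0" "q $ 1 \<noteq> 0" "p $ 1 \<noteq> 0"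
      using n1 n2 q(1) norm_vec2_squared[of q] by auto
    with True have "p = (p $ 1 / q $ 1) *s q" "p $ 1 / q $ 1 \<noteq> 0"
      by (simp_all add: vec_eq_iff forall_2)
    then show ?thesis using cp1_point_eq_iff by blast
  next
    case False
    then have p2: "p $ 2 \<noteq> 0" using n2 by auto
    have pq2: "p $ 2 * cnj (p $ 2) = q $ 2 * cnj (q $ 2)"
      by (simp flip: complex_norm_square add: n2)
    have "(p $ 1 * q $ 2) * (cnj (p $ 2) * cnj (q $ 2)) = (p $ 1 * cnj (p $ 2)) * (q $ 2 * cnj (q $ 2))"
      by (simp only: mult_ac)
    also have "\<dots> = (q $ 1 * cnj (q $ 2)) * (p $ 2 * cnj (p $ 2))"
      by (simp only: e pq2)
    also have "\<dots> = (p $ 2 * q $ 1) * (cnj (p $ 2) * cnj (q $ 2))"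
      by (simp only: mult_ac)
    finally have "(p $ 1 * q $ 2) * (cnj (p $ 2) * cnj (q $ 2)) = (p $ 2 * q $ 1) * (cnj (p $ 2) * cnj (q $ 2))" .
    then have "p $ 1 * q $ 2 = p $ 2 * q $ 1" using p2 False by simp
    then have "p = (p $ 2 / q $ 2) *s q" "p $ 2 / q $ 2 \<noteq> 0"
      using False p2 by (simp_all add: vec_eq_iff forall_2 field_simps)
    then show ?thesis using cp1_point_eq_iff by blast
  qed
  with p q show ?thesis by simp
qed

lemma hopf_map_surj:
  assumes "norm y = 1"
  shows "\<exists>v. v \<noteq> 0 \<and> hopf_map v = y"
proof (cases y)
  case (Pair z t)
  have zt: "(norm z)\<^sup>2 = (1 + t) * (1 - t)"
    using assms by (simp add: Pair norm_Pair algebra_simps power2_eq_square)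
  \<comment> \<open>The preimage \<open>(1 + t, cnj z)\<close> vanishes exactly at the south pole, the image of \<open>(0, 1)\<close>.\<close>
  show ?thesis
  proof (cases "t = -1")
    case True
    then have "z = 0" using zt by simp
    let ?v = "(\<chi> i. if i = 1 then 0 else 1) :: complex ^ 2"
    have "?v \<noteq> 0" by (simp add: vec_eq_iff forall_2)
    moreover have "hopf_map ?v = y"
      by (simp add: hopf_map_def norm_vec2_squared Pair True \<open>z = 0\<close>)
    ultimately show ?thesis by blast
  next
    case False
    let ?v = "(\<chi> i. if i = 1 then of_real (1 + t) else cnj z) :: complex ^ 2"
    have v: "?v $ 1 = of_real (1 + t)" "?v $ 2 = cnj z" by simp_all
    have t: "1 + t \<noteq> 0" "complex_of_real (1 + t) \<noteq> 0" using False by (auto simp del: of_real_add)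
    have n: "(norm ?v)\<^sup>2 = 2 * (1 + t)"
      unfolding norm_vec2_squared v by (simp add: zt del: of_real_add) (simp add: power2_eq_square algebra_simps)
    have "?v \<noteq> 0" using v(1) t(2) by (metis zero_index)
    moreover have "(norm (?v $ 1))\<^sup>2 - (norm (?v $ 2))\<^sup>2 = t * (2 * (1 + t))"
      unfolding v by (simp add: zt del: of_real_add) (simp add: power2_eq_square algebra_simps)
    then have "hopf_map ?v = y"
    proof -
      assume d: "(norm (?v $ 1))\<^sup>2 - (norm (?v $ 2))\<^sup>2 = t * (2 * (1 + t))"
      have "2 * of_real (1 + t) * cnj (cnj z) / of_real (2 * (1 + t)) = z"
        using t(2) unfolding of_real_mult complex_cnj_cnj of_real_numeral
        by (metis mult_divide_mult_cancel_left nonzero_mult_div_cancel_left zero_neq_numeral mult_eq_0_iff)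
      then show ?thesis
        using t unfolding hopf_map_def n Pair d by (simp add: v del: of_real_add of_real_mult)
    qed
    ultimately show ?thesis by blast
  qed
qed

lemma compact_space_cp1: "compact_space cp1_topology"
proof -
  have "cp1_carrier \<subseteq> cp1_point ` sphere 0 1"
  proof
    fix P assume "P \<in> cp1_carrier"
    then obtain v where v: "v \<noteq> 0" "P = cp1_point v" by (auto simp: cp1_carrier_def)
    have "v = of_real (norm v) *s (v /\<^sub>R norm v)"
      using v(1) by (auto simp: vec_eq_iff scaleR_conv_of_real[where 'a = complex] simp flip: of_real_mult)
    moreover have "of_real (norm v) \<noteq> (0::complex)" using v(1) by simp
    ultimately have "P = cp1_point (v /\<^sub>R norm v)" using v(2) cp1_point_eq_iff by blast
    moreover have "v /\<^sub>R norm v \<in> sphere 0 1" using v(1) by simp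
    ultimately show "P \<in> cp1_point ` sphere 0 1" by blast
  qed
  moreover have "cp1_point ` sphere 0 1 \<subseteq> cp1_carrier"
    unfolding cp1_carrier_def by (rule image_mono) auto
  moreover have "compactin cp1_topology (cp1_point ` sphere 0 1)"
  proof (rule image_compactin[OF _ continuous_map_cp1_point])
    show "compactin (top_of_set (- {0})) (sphere (0 :: complex ^ 2) 1)"
      unfolding compactin_subtopology compactin_euclidean_iff by auto
  qed
  ultimately show ?thesis by (simp add: compact_space_def subset_antisym)
qed

lemma cp1_homeomorphic_sphere:
  "cp1_topology homeomorphic_space top_of_set (sphere (0 :: complex \<times> real) 1)"
proof -
  define h where "h P = hopf_map (SOME v. v \<noteq> 0 \<and> P = cp1_point v)" for P
  have h: "h (cp1_point v) = hopf_map v" if "v \<noteq> 0" for v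
  proof -
    define u where "u = (SOME u. u \<noteq> 0 \<and> cp1_point v = cp1_point u)"
    have "u \<noteq> 0 \<and> cp1_point v = cp1_point u"
      unfolding u_def by (rule someI[of _ v]) (simp add: that)
    then obtain c where "c \<noteq> 0" "v = c *s u"
      unfolding cp1_point_eq_iff by blast
    then have "hopf_map v = hopf_map u" by (simp add: hopf_map_scale)
    then show ?thesis by (simp only: h_def u_def)
  qed
  have cont_hopf: "continuous_on (- {0}) hopf_map"
    unfolding hopf_map_def by (intro continuous_intros) auto
  have "continuous_map cp1_topology euclidean h"
    unfolding continuous_map_def
  proof (intro conjI allI impI)
    fix U :: "(complex \<times> real) set" assume "openin euclidean U"
    moreover have "open (- {0} :: (complex ^ 2) set)" by (simp add: open_Compl)
    ultimately have "open (- {0} \<inter> hopf_map -` U)"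
      using cont_hopf by (simp add: continuous_on_open_vimage Int_commute)
    moreover have "{v. v \<noteq> 0 \<and> cp1_point v \<in> {P \<in> cp1_carrier. h P \<in> U}} = - {0} \<inter> hopf_map -` U"
      by (auto simp: cp1_carrier_def h)
    ultimately show "openin cp1_topology {P \<in> topspace cp1_topology. h P \<in> U}"
      by (simp add: openin_cp1_topology)
  qed auto
  moreover have im: "h ` cp1_carrier = sphere 0 1"
  proof (intro equalityI subsetI)
    show "y \<in> sphere 0 1" if "y \<in> h ` cp1_carrier" for y
    proof -
      from that obtain v where "v \<noteq> 0" "y = h (cp1_point v)" by (auto simp: cp1_carrier_def)
      then show ?thesis by (simp add: h norm_hopf_map)
    qed
    show "y \<in> h ` cp1_carrier" if y: "y \<in> sphere 0 1" for y
    proof -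
      have "norm y = 1" using y by (simp only: mem_sphere_0)
      then obtain v where v: "v \<noteq> 0" "hopf_map v = y"
        using hopf_map_surj by blast
      then have "y = h (cp1_point v)" "cp1_point v \<in> cp1_carrier" by (simp_all add: h cp1_carrier_def)
      then show ?thesis by (rule image_eqI)
    qed
  qed
  ultimately have "continuous_map cp1_topology (top_of_set (sphere 0 1)) h"
    by (auto simp: continuous_map_in_subtopology)
  then have "homeomorphic_map cp1_topology (top_of_set (sphere 0 1)) h"
  proof (rule continuous_imp_homeomorphic_map)
    show "inj_on h (topspace cp1_topology)"
    proof (rule inj_onI)
      fix P Q assume PQ: "P \<in> topspace cp1_topology" "Q \<in> topspace cp1_topology" "h P = h Q"
      then obtain v w where "v \<noteq> 0" "P = cp1_point v" "w \<noteq> 0" "Q = cp1_point w"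
        by (auto simp: cp1_carrier_def)
      with PQ(3) show "P = Q" by (simp add: h hopf_map_eq_imp[of v w])
    qed
    show "compact_space cp1_topology" by (rule compact_space_cp1)
    show "Hausdorff_space (top_of_set (sphere (0 :: complex \<times> real) 1))"
      by (simp add: Hausdorff_space_subtopology)
    show "h ` topspace cp1_topology = topspace (top_of_set (sphere 0 1))"
      by (simp add: im del: mem_sphere_0)
  qed
  then show ?thesis by (rule homeomorphic_map_imp_homeomorphic_space)
qed

text \<open>The integral homology of spheres is computed for \<open>nsphere n\<close>, whose points are real sequences
  vanishing beyond the first \<open>n + 1\<close> coordinates.\<close>

lemma sphere_homeomorphic_nsphere:
  "top_of_set (sphere (0 :: complex \<times> real) 1) homeomorphic_space nsphere 2"
proof -
  define f :: "complex \<times> real \<Rightarrow> nat \<Rightarrow> real" where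
    "f p i = (if i = 0 then Re (fst p) else if i = 1 then Im (fst p) else if i = 2 then snd p else 0)"
    for p i
  define g :: "(nat \<Rightarrow> real) \<Rightarrow> complex \<times> real" where "g x = (Complex (x 0) (x 1), x 2)" for x
  have sph: "p \<in> sphere 0 1 \<longleftrightarrow> (Re (fst p))\<^sup>2 + (Im (fst p))\<^sup>2 + (snd p)\<^sup>2 = 1" for p :: "complex \<times> real"
    by (cases p) (simp add: norm_Pair cmod_power2)
  have nsph: "x \<in> topspace (nsphere 2) \<longleftrightarrow> (x 0)\<^sup>2 + (x 1)\<^sup>2 + (x 2)\<^sup>2 = 1 \<and> (\<forall>i>2. x i = 0)" for x
    by (simp add: nsphere numeral_2_eq_2 atMost_Suc add_ac)
  have cf: "continuous_map (top_of_set (sphere 0 1)) (nsphere 2) f"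
    unfolding nsphere continuous_map_in_subtopology continuous_map_componentwise_UNIV
  proof (intro conjI allI)
    show "continuous_map (top_of_set (sphere 0 1)) euclideanreal (\<lambda>p. f p i)" for i
      unfolding f_def continuous_map_iff_continuous
      by (cases "i = 0"; cases "i = 1"; cases "i = 2") (auto intro!: continuous_intros)
    show "f \<in> topspace (top_of_set (sphere 0 1)) \<rightarrow> {x. (\<Sum>i\<le>2. (x i)\<^sup>2) = 1 \<and> (\<forall>i>2. x i = 0)}"
      by (auto simp: f_def sph numeral_2_eq_2 atMost_Suc add_ac simp del: mem_sphere mem_sphere_0)
  qed
  have "continuous_map (nsphere 2) euclidean g"
  proof -
    have proj: "continuous_map (nsphere 2) euclideanreal (\<lambda>x. x k)" for k
      by (rule continuous_map_nsphere_projection)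
    have cplx: "continuous_map (nsphere 2) euclidean (\<lambda>x. Complex (x 0) (x 1))"
    proof -
      have "continuous_map (nsphere 2) euclidean (\<lambda>x. (x 0, x 1))"
        unfolding prod_topology_euclidean[symmetric] continuous_map_pairwise
        using proj by (simp add: o_def)
      moreover have "continuous_map euclidean euclidean (\<lambda>(a, b). Complex a b)"
        by (simp add: case_prod_beta Complex_eq continuous_intros)
      ultimately have "continuous_map (nsphere 2) euclidean ((\<lambda>(a, b). Complex a b) \<circ> (\<lambda>x. (x 0, x 1)))"
        by (rule continuous_map_compose)
      then show ?thesis by (simp add: o_def)
    qed
    show ?thesis
      unfolding g_def prod_topology_euclidean[symmetric] continuous_map_pairwise
      using proj cplx by (simp add: o_def)
  qed
  then have cg: "continuous_map (nsphere 2) (top_of_set (sphere 0 1)) g"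
    by (auto simp: continuous_map_in_subtopology sph nsph g_def simp del: mem_sphere mem_sphere_0)
  have "homeomorphic_maps (top_of_set (sphere 0 1)) (nsphere 2) f g"
    unfolding homeomorphic_maps_def using cf cg
    by (auto simp: nsph f_def g_def fun_eq_iff)
  then show ?thesis by (auto simp: homeomorphic_space_def)
qed

section \<open>Simple connectedness\<close>

lemma simply_connected_space_top_of_set:
  fixes S :: "'b::real_normed_vector set"
  assumes "simply_connected S"
  shows "simply_connected_space (top_of_set S)"
proof -
  have "homotopic_with (\<lambda>q. q 0 = p 0 \<and> q 1 = p 0) (top_of_set {0..1}) (top_of_set S) p (\<lambda>_. p 0)"
    if p: "pathin (top_of_set S) p" "p 1 = p 0" for p
  proof -
    have "path p" "path_image p \<subseteq> S" "p 0 \<in> S"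
      using p by (auto simp: pathin_canon_iff path_image_def)
    moreover have "path (\<lambda>_. p 0)" "path_image (\<lambda>_. p 0) \<subseteq> S"
      using \<open>p 0 \<in> S\<close> by (auto simp: path_def path_image_def)
    moreover have "pathstart (\<lambda>_. p 0) = pathstart p" "pathfinish (\<lambda>_. p 0) = pathfinish p"
      using p(2) by (simp_all add: pathstart_def pathfinish_def)
    ultimately have "homotopic_paths S p (\<lambda>_. p 0)"
      using assms unfolding simply_connected_eq_homotopic_paths by blast
    then show ?thesis
      by (simp add: homotopic_paths_def pathstart_def pathfinish_def p(2))
  qed
  moreover have "path_connected S"
    using assms simply_connected_imp_path_connected by blast
  ultimately show ?thesis
    by (simp add: simply_connected_space_def)
qed

lemma simply_connected_space_homeomorphic:
  assumes "X homeomorphic_space Y" and Y: "simply_connected_space Y"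
  shows "simply_connected_space X"
proof -
  obtain f g where f: "continuous_map X Y f" and g: "continuous_map Y X g"
    and gf: "\<And>x. x \<in> topspace X \<Longrightarrow> g (f x) = x"
    using assms(1) by (auto simp: homeomorphic_space_def homeomorphic_maps_def)
  have "homotopic_with (\<lambda>q. q 0 = p 0 \<and> q 1 = p 0) (top_of_set {0..1}) X p (\<lambda>_. p 0)"
    if p: "pathin X p" "p 1 = p 0" for p
  proof -
    have px: "p t \<in> topspace X" if "t \<in> {0..1}" for t
      using p(1) that by (auto simp: pathin_def continuous_map_def)
    have "pathin Y (f \<circ> p)" using f p(1) pathin_compose by blast
    then have "homotopic_with (\<lambda>q. q 0 = f (p 0) \<and> q 1 = f (p 0)) (top_of_set {0..1}) Y (f \<circ> p) (\<lambda>_. f (p 0))"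
      using Y p(2) by (auto simp: simply_connected_space_def)
    then have "homotopic_with (\<lambda>q. q 0 = p 0 \<and> q 1 = p 0) (top_of_set {0..1}) X (g \<circ> (f \<circ> p)) (g \<circ> (\<lambda>_. f (p 0)))"
      by (rule homotopic_with_compose_continuous_map_left[OF _ g]) (auto simp: gf px)
    then show ?thesis
      by (rule homotopic_with_eq) (auto simp: gf px)
  qed
  moreover have "path_connected_space X"
    using assms homeomorphic_path_connected_space by (auto simp: simply_connected_space_def)
  ultimately show ?thesis
    by (simp add: simply_connected_space_def)
qed

section \<open>First homology with complex coefficients\<close>

lemma integral_cycle_imp_boundary:
  assumes "trivial_group (homology_group (int p) X)" "singular_relcycle p X {} c"
  shows "\<exists>d. singular_chain (Suc p) X d \<and> chain_boundary (Suc p) d = c"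
proof -
  have "homologous_rel_set p X {} c \<in> carrier (homology_group (int p) X)"
    using assms(2) by (auto simp: carrier_relative_homology_group)
  then have "homologous_rel_set p X {} c = singular_relboundary_set p X {}"
    using assms(1) by (simp add: trivial_group_def)
  then show ?thesis
    by (simp add: homologous_rel_set_eq_relboundary singular_boundary)
qed

text \<open>The complex linear extension of a map from singular simplices to integral chains.\<close>

definition complex_extend :: "(((nat \<Rightarrow> real) \<Rightarrow> 'a) \<Rightarrow> 'a chain) \<Rightarrow> 'a complex_chain \<Rightarrow> 'a complex_chain" where
  "complex_extend F c =
     (\<Sum>f\<in>Poly_Mapping.keys c. chain_scale (Poly_Mapping.lookup c f) (complexify_chain (F f)))"

lemma complex_extend_superset:
  assumes "finite S" "Poly_Mapping.keys c \<subseteq> S"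
  shows "complex_extend F c =
    (\<Sum>f\<in>S. chain_scale (Poly_Mapping.lookup c f) (complexify_chain (F f)))"
  using assms unfolding complex_extend_def
  by (intro sum.mono_neutral_left) (auto simp: in_keys_iff chain_scale_simps)

lemma complex_extend_0: "complex_extend F 0 = 0"
  by (simp add: complex_extend_def)

lemma complex_extend_add: "complex_extend F (c + d) = complex_extend F c + complex_extend F d"
proof -
  let ?S = "Poly_Mapping.keys c \<union> Poly_Mapping.keys d"
  have "finite ?S" "Poly_Mapping.keys (c + d) \<subseteq> ?S"
    using Poly_Mapping.keys_add[of c d] by auto
  then show ?thesis
    by (simp add: complex_extend_superset[of ?S] lookup_add chain_scale_simps sum.distrib)
qed

lemma complex_extend_single:
  "complex_extend F (Poly_Mapping.single f a) = chain_scale a (complexify_chain (F f))"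
  by (simp add: complex_extend_superset[of "{f}"])

lemma complex_extend_sum: "complex_extend F (\<Sum>i\<in>I. c i) = (\<Sum>i\<in>I. complex_extend F (c i))"
  by (induction I rule: infinite_finite_induct) (simp_all add: complex_extend_add complex_extend_0)

text \<open>The passage from integral to complex coefficients in degree one: each simplex of a complex cycle
  is closed up to an integral cycle by paths to a base point.\<close>

lemma complex_1_cycle_imp_boundary:
  assumes X: "path_connected_space X" and triv: "trivial_group (homology_group 1 X)"
    and c: "c \<in> complex_cycles 1 X"
  shows "c \<in> complex_boundaries 1 X"
proof (cases "c = 0")
  case True
  then show ?thesis
    unfolding complex_boundaries_def
    by (metis complex_chain_boundary_0 complex_chains_closed(1) image_eqI)
next
  case False
  \<comment> \<open>A nonzero chain has a simplex, whose face 0 serves as base point.\<close>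
  then obtain \<sigma>0 where "\<sigma>0 \<in> Poly_Mapping.keys c" by (metis keys_eq_empty ex_in_conv)
  let ?f0 = "singular_face 1 0" and ?f1 = "singular_face 1 1"
  have simplex: "singular_simplex 1 X \<sigma>" if "\<sigma> \<in> Poly_Mapping.keys c" for \<sigma>
    using c that by (auto simp: complex_cycles_def complex_chains_def)
  have face: "singular_simplex 0 X (singular_face 1 k \<sigma>)" if "singular_simplex 1 X \<sigma>" "k \<le> 1" for \<sigma> k
    using singular_simplex_singular_face[OF that(1)] that(2) by simp
  define b where "b = ?f0 \<sigma>0"
  have b: "singular_simplex 0 X b"
    using simplex[OF \<open>\<sigma>0 \<in> _\<close>] face by (simp add: b_def)
  have "\<exists>\<gamma>. singular_simplex 0 X s \<longrightarrow> singular_chain 1 X \<gamma> \<and> chain_boundary 1 \<gamma> = frag_of s - frag_of b" for s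
    using iso_integer_zeroth_homology_group_aux[OF X _ b]
    by (auto simp: homologous_rel_def singular_boundary)
  then obtain \<gamma> where \<gamma>: "\<And>s. singular_simplex 0 X s \<Longrightarrow>
      singular_chain 1 X (\<gamma> s) \<and> chain_boundary 1 (\<gamma> s) = frag_of s - frag_of b"
    by metis
  \<comment> \<open>The boundary of a path \<open>\<sigma>\<close> is its face 0 minus its face 1.\<close>
  define z where "z \<sigma> = frag_of \<sigma> + \<gamma> (?f1 \<sigma>) - \<gamma> (?f0 \<sigma>)" for \<sigma>
  have "singular_relcycle 1 X {} (z \<sigma>)" if "singular_simplex 1 X \<sigma>" for \<sigma>
  proof -
    have "singular_chain 1 X (z \<sigma>)"
      unfolding z_def using that \<gamma> face
      by (intro singular_chain_diff singular_chain_add) (auto simp: singular_chain_of)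
    moreover have "chain_boundary 1 (z \<sigma>) = 0"
      using \<gamma> face[OF that]
      by (simp add: z_def chain_boundary_add chain_boundary_diff chain_boundary_of)
    ultimately show ?thesis by (simp add: singular_cycle)
  qed
  then have "\<exists>d. singular_simplex 1 X \<sigma> \<longrightarrow> singular_chain 2 X d \<and> chain_boundary 2 d = z \<sigma>" for \<sigma>
    using integral_cycle_imp_boundary[of 1 X "z \<sigma>"] triv by (auto simp: numeral_2_eq_2)
  then obtain d where d: "\<And>\<sigma>. singular_simplex 1 X \<sigma> \<Longrightarrow> singular_chain 2 X (d \<sigma>) \<and> chain_boundary 2 (d \<sigma>) = z \<sigma>"
    by metis
  have bd: "complex_chain_boundary 1 c = (\<Sum>\<sigma>\<in>Poly_Mapping.keys c.
      Poly_Mapping.single (?f0 \<sigma>) (Poly_Mapping.lookup c \<sigma>) + Poly_Mapping.single (?f1 \<sigma>) (- Poly_Mapping.lookup c \<sigma>))"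
    by (simp add: complex_chain_boundary_def)
  \<comment> \<open>As \<open>c\<close> is a cycle, the connecting paths cancel when weighted with its coefficients.\<close>
  have "complex_extend \<gamma> (complex_chain_boundary 1 c) = 0"
    using c by (simp add: complex_cycles_def complex_extend_0)
  then have zero: "(\<Sum>\<sigma>\<in>Poly_Mapping.keys c.
      chain_scale (Poly_Mapping.lookup c \<sigma>) (complexify_chain (\<gamma> (?f0 \<sigma>))) +
      chain_scale (- Poly_Mapping.lookup c \<sigma>) (complexify_chain (\<gamma> (?f1 \<sigma>)))) = 0"
    by (simp only: bd complex_extend_sum complex_extend_add complex_extend_single)
  have "complex_chain_boundary 2 (complex_extend d c) =
     (\<Sum>\<sigma>\<in>Poly_Mapping.keys c. chain_scale (Poly_Mapping.lookup c \<sigma>) (complexify_chain (z \<sigma>)))"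
    using d simplex
    by (simp add: complex_extend_def complex_chain_boundary_sum complex_chain_boundary_scale
        complex_chain_boundary_complexify)
  also have "\<dots> = (\<Sum>\<sigma>\<in>Poly_Mapping.keys c. chain_scale (Poly_Mapping.lookup c \<sigma>) (complexify_chain (z \<sigma>))) +
    (\<Sum>\<sigma>\<in>Poly_Mapping.keys c.
      chain_scale (Poly_Mapping.lookup c \<sigma>) (complexify_chain (\<gamma> (?f0 \<sigma>))) +
      chain_scale (- Poly_Mapping.lookup c \<sigma>) (complexify_chain (\<gamma> (?f1 \<sigma>))))"
    by (simp only: zero add_0_right)
  also have "\<dots> = (\<Sum>\<sigma>\<in>Poly_Mapping.keys c. chain_scale (Poly_Mapping.lookup c \<sigma>) (complexify_chain (frag_of \<sigma>)))"
    unfolding sum.distrib[symmetric]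
    by (intro sum.cong refl poly_mapping_eqI) (simp add: z_def lookup_add lookup_minus algebra_simps)
  also have "\<dots> = c" by (rule complex_chain_expand[symmetric])
  finally have "complex_chain_boundary (Suc 1) (complex_extend d c) = c" by (simp add: numeral_2_eq_2)
  moreover have "complex_extend d c \<in> complex_chains (Suc 1) X"
  proof -
    have "complexify_chain (d \<sigma>) \<in> complex_chains (Suc 1) X" if "\<sigma> \<in> Poly_Mapping.keys c" for \<sigma>
      using d[OF simplex[OF that]]
      by (auto simp: complex_chains_def singular_chain_def in_keys_iff subset_iff numeral_2_eq_2)
    then have "(\<Sum>\<sigma>\<in>I. chain_scale (Poly_Mapping.lookup c \<sigma>) (complexify_chain (d \<sigma>))) \<in> complex_chains (Suc 1) X"
      if "I \<subseteq> Poly_Mapping.keys c" for I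
      using that by (induction I rule: infinite_finite_induct) (auto simp: complex_chains_closed)
    then show ?thesis by (simp add: complex_extend_def)
  qed
  ultimately show ?thesis
    unfolding complex_boundaries_def by (metis image_eqI)
qed

lemma complex_boundaries_add:
  assumes "c \<in> complex_boundaries p X" "d \<in> complex_boundaries p X"
  shows "c + d \<in> complex_boundaries p X"
  using assms unfolding complex_boundaries_def
  by (auto simp: complex_chains_closed simp flip: complex_chain_boundary_add)

lemma complex_boundaries_scale:
  assumes "c \<in> complex_boundaries p X"
  shows "chain_scale a c \<in> complex_boundaries p X"
  using assms unfolding complex_boundaries_def
  by (auto simp: complex_chains_closed simp flip: complex_chain_boundary_scale)

lemma complex_homology_1_trivial:
  assumes "path_connected_space X" "trivial_group (homology_group 1 X)"
  shows "carrier (complex_homology 1 X) = {\<zero>\<^bsub>complex_homology 1 X\<^esub>}"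
proof -
  interpret vectorspace complex_field "complex_homology 1 X"
    by (rule vectorspace_complex_homology)
  let ?M = "complex_cycle_module 1 X"
  have zero: "\<zero>\<^bsub>complex_homology 1 X\<^esub> = complex_boundaries 1 X"
    by (simp add: complex_homology_def quotient_module_def)
  have "C = complex_boundaries 1 X" if "C \<in> carrier (complex_homology 1 X)" for C
  proof -
    from that obtain c where c: "c \<in> complex_cycles 1 X" "C = complex_boundaries 1 X +>\<^bsub>?M\<^esub> c"
      by (auto simp: complex_homology_def quotient_module_def A_RCOSETS_def' complex_cycle_module_def)
    have cb: "c \<in> complex_boundaries 1 X"
      by (rule complex_1_cycle_imp_boundary[OF assms c(1)])
    have C: "C = (\<lambda>h. h + c) ` complex_boundaries 1 X"
      unfolding c(2) by (auto simp: a_r_coset_def' complex_cycle_module_def)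
    show ?thesis
    proof (intro equalityI subsetI)
      show "x \<in> complex_boundaries 1 X" if "x \<in> C" for x
        using that complex_boundaries_add[OF _ cb] unfolding C by blast
      show "x \<in> C" if "x \<in> complex_boundaries 1 X" for x
      proof -
        have "x = (x + chain_scale (-1) c) + c"
          by (simp only: add.assoc chain_scale_minus add_0_right)
        moreover have "x + chain_scale (-1) c \<in> complex_boundaries 1 X"
          by (intro complex_boundaries_add complex_boundaries_scale that cb)
        ultimately show ?thesis unfolding C by (rule image_eqI)
      qed
    qed
  qed
  then show ?thesis using zero_closed zero by auto
qed

lemma (in vectorspace) dim_trivial:
  assumes "carrier V = {\<zero>\<^bsub>V\<^esub>}"
  shows "dim = 0"
proof -
  have "span {} = carrier V"
    using assms by (auto simp: span_def lincomb_def)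
  then show ?thesis
    using gen_ge_dim[of "{}"] by simp
qed

theorem theorem11p1:
  fixes X :: "'a topology" and A :: "'a chart set"
  assumes "riemann_surface X A"
    and "compact_space X"
    and "biholomorphic X A cp1_topology cp1_atlas"
  shows "simply_connected_space X \<and>
         carrier (complex_homology 1 X) = {\<zero>\<^bsub>complex_homology 1 X\<^esub>} \<and>
         genus X = 0"
proof (intro conjI)
  have "X homeomorphic_space cp1_topology"
    using assms(3) unfolding biholomorphic_def holomorphic_map_def
    by (auto simp: homeomorphic_space_def homeomorphic_maps_def)
  then have X: "X homeomorphic_space top_of_set (sphere (0 :: complex \<times> real) 1)"
    using cp1_homeomorphic_sphere homeomorphic_space_trans by blast
  show sc: "simply_connected_space X"
    by (rule simply_connected_space_homeomorphic[OF X simply_connected_space_top_of_set])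
      (simp add: simply_connected_sphere)
  have "nsphere 2 homeomorphic_space X"
    using X sphere_homeomorphic_nsphere homeomorphic_space_trans homeomorphic_space_sym by blast
  then have "homology_group 1 (nsphere 2) \<cong> homology_group 1 X"
    by (rule homeomorphic_space_imp_isomorphic_homology_groups)
  moreover have "trivial_group (homology_group 1 (nsphere 2))"
    using reduced_homology_group_nsphere(2)[of 1 2] by (simp add: un_reduced_homology_group)
  ultimately have "trivial_group (homology_group 1 X)"
    using isomorphic_group_triviality1 group_relative_homology_group by blast
  then show triv: "carrier (complex_homology 1 X) = {\<zero>\<^bsub>complex_homology 1 X\<^esub>}"
    using sc complex_homology_1_trivial by (auto simp: simply_connected_space_def)
  show "genus X = 0"
    using vectorspace.dim_trivial[OF vectorspace_complex_homology triv]
    by (simp add: genus_def betti_number_def)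
qed

end
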